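(* Let $\mathcal{H}$ be a complex Hilbert space, let $A\in\mathcal{B}(\mathcal{H})$ be positive (semi-definite), let $\mathbb{A}=\begin{pmatrix}A&0\\0&A\end{pmatrix}$, and let $\mathbb{T}=\begin{pmatrix}P&Q\\R&S\end{pmatrix}$ with $P,Q,R,S\in\mathcal{B}_{A}(\mathcal{H})$. Then $$\omega_{\mathbb{A}}(\mathbb{T})\le\sqrt{2\omega_A^2(P)+\frac12\left(\|P^{\sharp_A}Q\|_A+\|Q\|_A^2\right)}+\sqrt{2\omega_A^2(S)+\frac12\left(\|S^{\sharp_A}R\|_A+\|R\|_A^2\right)}.$$
   Context: $\mathcal{B}(\mathcal{H})$ is the algebra of bounded linear operators on $\mathcal{H}$. The positive semi-definite operator $A$ induces the semi-inner product $\langle x\mid y\rangle_A=\langle Ax\mid y\rangle$ and the seminorm $\|x\|_A=\langle x\mid x\rangle_A^{1/2}=\|A^{1/2}x\|$. An operator $T\in\mathcal{B}(\mathcal{H})$ is $A$-bounded if there is $\lambda>0$ with $\|Tx\|_A\le\lambda\|x\|_A$ for all $x\in\mathcal{H}$; then $\|T\|_A=\sup\{\|Tx\|_A : x\in\mathcal{H},\ \|x\|_A=1\}$. The $A$-numerical radius is $\omega_A(T)=\sup\{|\langle Tx\mid x\rangle_A| : x\in\mathcal{H},\ \|x\|_A=1\}$, and $\omega_A^2(T)$ means $(\omega_A(T))^2$. $\mathcal{B}_A(\mathcal{H})$ is the set of $T\in\mathcal{B}(\mathcal{H})$ with $\mathcal{R}(T^*A)\subseteq\mathcal{R}(A)$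 ($\mathcal{R}$ denotes range), equivalently those admitting an $A$-adjoint, i.e. a bounded $X$ with $AX=T^*A$; all such $T$ are $A$-bounded. For $T\in\mathcal{B}_A(\mathcal{H})$, $T^{\sharp_A}$ is the unique bounded solution $X$ of $AX=T^*A$ with $\mathcal{R}(X)\subseteq\overline{\mathcal{R}(A)}$. The operator $\mathbb{A}$ is a positive operator on $\mathcal{H}\oplus\mathcal{H}$, with $\langle x,y\rangle_{\mathbb{A}}=\langle x_1\mid y_1\rangle_A+\langle x_2\mid y_2\rangle_A$ for $x=(x_1,x_2)$, $y=(y_1,y_2)$; $\|\cdot\|_{\mathbb{A}}$ and $\omega_{\mathbb{A}}$ are defined in the same way with $(\mathcal{H}\oplus\mathcal{H},\mathbb{A})$ in place of $(\mathcal{H},A)$. A $2\times2$ matrix of operators on $\mathcal{H}$ denotes the corresponding operator on $\mathcal{H}\oplus\mathcal{H}$. *)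

theory Defs
  imports "HOL-Analysis.Analysis"
begin

(* The inner product is linear in its first argument. The last axiom contains positive
   definiteness and says that the norm is the one induced by the inner product. *)
class complex_inner = real_normed_vector +
  fixes scaleC :: "complex \<Rightarrow> 'a \<Rightarrow> 'a" (infixr "*\<^sub>C" 75)
    and cinner :: "'a \<Rightarrow> 'a \<Rightarrow> complex"
  assumes scaleR_scaleC: "r *\<^sub>R x = complex_of_real r *\<^sub>C x"
    and scaleC_add_right: "c *\<^sub>C (x + y) = c *\<^sub>C x + c *\<^sub>C y"
    and scaleC_add_left: "(c + d) *\<^sub>C x = c *\<^sub>C x + d *\<^sub>C x"
    and scaleC_scaleC: "c *\<^sub>C d *\<^sub>C x = (c * d) *\<^sub>C x"
    and cinner_commute: "cinner x y = cnj (cinner y x)"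
    and cinner_add_left: "cinner (x + y) z = cinner x z + cinner y z"
    and cinner_scaleC_left: "cinner (c *\<^sub>C x) y = c * cinner x y"
    and cinner_self: "cinner x x = complex_of_real ((norm x)\<^sup>2)"

class chilbert_space = complex_inner + complete_space

(* Hilbert direct sum; the norm on the product type is already the l2 norm. *)
instantiation prod :: (complex_inner, complex_inner) complex_inner
begin

definition scaleC_prod :: "complex \<Rightarrow> 'a \<times> 'b \<Rightarrow> 'a \<times> 'b" where
  "scaleC_prod c x = (c *\<^sub>C fst x, c *\<^sub>C snd x)"

definition cinner_prod :: "'a \<times> 'b \<Rightarrow> 'a \<times> 'b \<Rightarrow> complex" where
  "cinner_prod x y = cinner (fst x) (fst y) + cinner (snd x) (snd y)"

instance
proof
  fix r :: real and c d :: complex and x y z :: "'a \<times> 'b"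
  show "r *\<^sub>R x = complex_of_real r *\<^sub>C x"
    by (simp add: scaleC_prod_def scaleR_prod_def scaleR_scaleC)
  show "c *\<^sub>C (x + y) = c *\<^sub>C x + c *\<^sub>C y"
    by (simp add: scaleC_prod_def scaleC_add_right)
  show "(c + d) *\<^sub>C x = c *\<^sub>C x + d *\<^sub>C x"
    by (simp add: scaleC_prod_def scaleC_add_left)
  show "c *\<^sub>C d *\<^sub>C x = (c * d) *\<^sub>C x"
    by (simp add: scaleC_prod_def scaleC_scaleC)
  show "cinner x y = cnj (cinner y x)"
    by (simp add: cinner_prod_def cinner_commute[of "fst x"] cinner_commute[of "snd x"])
  show "cinner (x + y) z = cinner x z + cinner y z"
    by (simp add: cinner_prod_def cinner_add_left)
  show "cinner (c *\<^sub>C x) y = c * cinner x y"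
    by (simp add: cinner_prod_def scaleC_prod_def cinner_scaleC_left algebra_simps)
  show "cinner x x = complex_of_real ((norm x)\<^sup>2)"
    by (simp add: cinner_prod_def cinner_self norm_prod_def)
qed

end

instance prod :: (chilbert_space, chilbert_space) chilbert_space ..

definition bounded_clinear :: "('a::complex_inner \<Rightarrow> 'b::complex_inner) \<Rightarrow> bool" where
  "bounded_clinear T \<longleftrightarrow> bounded_linear T \<and> (\<forall>c x. T (c *\<^sub>C x) = c *\<^sub>C T x)"

definition cadjoint :: "('a::chilbert_space \<Rightarrow> 'a) \<Rightarrow> 'a \<Rightarrow> 'a" where
  "cadjoint T = (THE T'. \<forall>x y. cinner (T x) y = cinner x (T' y))"

definition positive_op :: "('a::chilbert_space \<Rightarrow> 'a) \<Rightarrow> bool" where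
  "positive_op A \<longleftrightarrow> bounded_clinear A \<and> (\<forall>x. cinner (A x) x \<in> \<real>\<^sub>\<ge>\<^sub>0)"

definition A_inner :: "('a::chilbert_space \<Rightarrow> 'a) \<Rightarrow> 'a \<Rightarrow> 'a \<Rightarrow> complex" where
  "A_inner A x y = cinner (A x) y"

definition A_seminorm :: "('a::chilbert_space \<Rightarrow> 'a) \<Rightarrow> 'a \<Rightarrow> real" where
  "A_seminorm A x = sqrt (Re (A_inner A x x))"

(* The suprema below range over sets of nonnegative reals. Inserting 0 changes nothing
   except when no x has A-seminorm 1 (that is, A = 0), where it fixes the supremum of the
   empty set as 0. They are meaningful for A-bounded T only. *)
definition A_norm :: "('a::chilbert_space \<Rightarrow> 'a) \<Rightarrow> ('a \<Rightarrow> 'a) \<Rightarrow> real" where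
  "A_norm A T = Sup (insert 0 {A_seminorm A (T x) | x. A_seminorm A x = 1})"

definition A_numerical_radius :: "('a::chilbert_space \<Rightarrow> 'a) \<Rightarrow> ('a \<Rightarrow> 'a) \<Rightarrow> real" where
  "A_numerical_radius A T = Sup (insert 0 {cmod (A_inner A (T x) x) | x. A_seminorm A x = 1})"

definition B_A :: "('a::chilbert_space \<Rightarrow> 'a) \<Rightarrow> ('a \<Rightarrow> 'a) set" where
  "B_A A = {T. bounded_clinear T \<and> range (cadjoint T \<circ> A) \<subseteq> range A}"

definition A_adjoint :: "('a::chilbert_space \<Rightarrow> 'a) \<Rightarrow> ('a \<Rightarrow> 'a) \<Rightarrow> 'a \<Rightarrow> 'a" where
  "A_adjoint A T =
    (THE X. bounded_clinear X \<and> A \<circ> X = cadjoint T \<circ> A \<and> range X \<subseteq> closure (range A))"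

definition op_matrix ::
  "('a::chilbert_space \<Rightarrow> 'a) \<Rightarrow> ('a \<Rightarrow> 'a) \<Rightarrow> ('a \<Rightarrow> 'a) \<Rightarrow> ('a \<Rightarrow> 'a) \<Rightarrow> 'a \<times> 'a \<Rightarrow> 'a \<times> 'a" where
  "op_matrix P Q R S = (\<lambda>(x, y). (P x + Q y, R x + S y))"

end

theory Submission imports Defs begin

text \<open>
  For a vector \<open>(x, y)\<close> of seminorm one, the form of the operator matrix splits into one term per row,
  and the triangle inequality treats the rows separately. For the first row put \<open>s = \<parallel>x\<parallel>\<^sub>A\<close> and
  \<open>t = \<parallel>y\<parallel>\<^sub>A\<close>, so that \<open>s\<^sup>2 + t\<^sup>2 = 1\<close>. Then \<open>(a + b)\<^sup>2 \<le> 2 a\<^sup>2 + 2 b\<^sup>2\<close> gives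
  \<open>\<bar>\<langle>P x + Q y, x\<rangle>\<^sub>A\<bar>\<^sup>2 \<le> 2 \<bar>\<langle>P x, x\<rangle>\<^sub>A\<bar>\<^sup>2 + 2 \<bar>\<langle>Q y, x\<rangle>\<^sub>A\<bar>\<^sup>2 \<le> 2 \<omega>\<^sub>A(P)\<^sup>2 s\<^sup>4 + 2 \<parallel>Q\<parallel>\<^sub>A\<^sup>2 s\<^sup>2 t\<^sup>2\<close>,
  and \<open>s \<le> 1\<close>, \<open>s t \<le> 1/2\<close> turn this into \<open>2 \<omega>\<^sub>A(P)\<^sup>2 + \<parallel>Q\<parallel>\<^sub>A\<^sup>2 / 2\<close> (\<open>matrix_row_bound\<close>). The claimed bound adds to this half
  the seminorm of \<open>P\<^sup>\<sharp> Q\<close>, which is nonnegative.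
  
  The analytic content lies in showing that these suprema are taken over bounded sets: a supremum of
  an unbounded set of reals carries no information, not even its sign. So every \<open>T\<close> in
  \<open>B_A A\<close>, and its A-adjoint, must be shown to be A-bounded. This takes three steps.
  The Riesz representation theorem provides the Hilbert space adjoint. The range inclusion defining
  \<open>B_A A\<close> then gives a solution \<open>X\<close> of \<open>A X = T\<^sup>* A\<close> with values in the closure of
  the range of \<open>A\<close>, whose continuity follows from the uniform boundedness principle
  (\<open>A_adjoint_exists\<close>, a case of Douglas' lemma). Finally \<open>X T\<close> is bounded
  and symmetric for the A-form, and an argument of Krein shows that such operators are A-bounded
  (\<open>A_symmetric_A_bounded\<close>). Because \<open>\<parallel>T x\<parallel>\<^sub>A\<^sup>2 = \<langle>X T x, x\<rangle>\<^sub>A\<close>, so is \<open>T\<close>, and by duality so is \<open>X\<close>.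
\<close>

section \<open>Complex inner products and positive operators\<close>

subclass (in chilbert_space) banach ..

lemma cinner_add_right: "cinner x (y + z) = cinner x y + cinner x z"
  for x y z :: "'a::complex_inner"
  by (simp add: cinner_commute[of x] cinner_add_left)

lemma cinner_scaleC_right: "cinner x (c *\<^sub>C y) = cnj c * cinner x y"
  for x y :: "'a::complex_inner"
  by (simp add: cinner_commute[of x] cinner_scaleC_left)

lemma minus_eq_scaleC: "- x = (- 1) *\<^sub>C x" for x :: "'a::complex_inner"
  using scaleR_scaleC[of "- 1" x] by simp

lemma cinner_diff_left: "cinner (x - y) z = cinner x z - cinner y z"
  for x y z :: "'a::complex_inner"
  using cinner_add_left[of "x - y" y z] by simp

lemma cinner_diff_right: "cinner x (y - z) = cinner x y - cinner x z"
  for x y z :: "'a::complex_inner"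
  using cinner_add_right[of x "y - z" z] by simp

lemma cinner_zero_left: "cinner 0 y = 0" for y :: "'a::complex_inner"
  using cinner_diff_left[of 0 0 y] by simp

lemma cinner_zero_right: "cinner y 0 = 0" for y :: "'a::complex_inner"
  using cinner_diff_right[of y 0 0] by simp

lemma cinner_eq_zero_imp: "cinner x x = 0 \<Longrightarrow> x = 0" for x :: "'a::complex_inner"
  by (simp add: cinner_self)

lemma cinner_eqI: "(\<And>z. cinner z x = cinner z y) \<Longrightarrow> x = y" for x y :: "'a::complex_inner"
  using cinner_eq_zero_imp[of "x - y"] by (simp add: cinner_diff_right)

lemma cinner_eqI_left: "(\<And>z. cinner x z = cinner y z) \<Longrightarrow> x = y" for x y :: "'a::complex_inner"
  using cinner_eq_zero_imp[of "x - y"] by (simp add: cinner_diff_left)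

lemma bounded_clinearD:
  assumes "bounded_clinear T"
  shows "bounded_linear T" "T (x + y) = T x + T y" "T (x - y) = T x - T y"
    "T (c *\<^sub>C x) = c *\<^sub>C T x" "T 0 = 0"
  using assms unfolding bounded_clinear_def
  by (auto simp: linear_simps)

lemma bounded_clinear_compose:
  assumes "bounded_clinear S" "bounded_clinear T"
  shows "bounded_clinear (S \<circ> T)"
  using assms bounded_linear_compose[of S T]
  unfolding bounded_clinear_def by (auto simp: o_def)

text \<open>
  The identity makes every fact about A-forms available for the inner product itself.
\<close>

lemma positive_op_id: "positive_op (id :: 'a::chilbert_space \<Rightarrow> 'a)"
  by (auto simp: positive_op_def bounded_clinear_def cinner_self id_def)

text \<open>
  Over the complex numbers a form with real diagonal is Hermitian, by polarization: the diagonal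
  values at \<open>x + y\<close> and \<open>x + \<i> y\<close> control the imaginary and the real part of the difference
  between the form and its conjugate transpose.
\<close>

lemma positive_op_selfadjoint:
  assumes A: "positive_op A"
  shows "cinner (A x) y = cinner x (A y)"
proof -
  note lin = bounded_clinearD[OF conjunct1[OF A[unfolded positive_op_def]]]
  have real: "Im (cinner (A z) z) = 0" for z
    using A unfolding positive_op_def by (auto simp: complex_nonneg_Reals_iff)
  have "Im (cinner (A x) y + cinner (A y) x) = 0"
    using real[of "x + y"] real[of x] real[of y]
    by (simp add: lin cinner_add_left cinner_add_right)
  moreover have "Re (cinner (A x) y) = Re (cinner (A y) x)"
    using real[of "x + \<i> *\<^sub>C y"] real[of x] real[of y]
    by (simp add: lin cinner_add_left cinner_add_right cinner_scaleC_left cinner_scaleC_right)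
  ultimately have "cinner (A x) y = cnj (cinner (A y) x)"
    by (auto simp: complex_eq_iff)
  then show ?thesis
    by (simp add: cinner_commute[of x])
qed

text \<open>
  The step common to the Cauchy-Schwarz inequality and to the orthogonality of a closest point:
  \<open>a\<close>, \<open>b\<close> are squared seminorms and \<open>s\<close> is the square of the modulus of an inner product. For
  \<open>b > 0\<close> the parabola is evaluated at its minimum over \<open>t\<close> when \<open>s > 0\<close>; for \<open>b = 0\<close> it is a
  line, which is nonnegative only if \<open>s = 0\<close>.
\<close>

lemma nonneg_parabola_imp:
  fixes a b s :: real
  assumes "\<And>t. 0 \<le> a - 2 * t * s + t\<^sup>2 * (s * b)" "0 \<le> s" "0 \<le> b"
  shows "s \<le> a * b"
proof (cases "b = 0")
  case True
  show ?thesis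
  proof (cases "s = 0")
    case False
    then have "0 \<le> a - 2 * (a + 1)"
      using assms(1)[of "(a + 1) / s"] True by simp
    then show ?thesis using assms(1)[of 0] by simp
  qed (use True in simp)
next
  case False
  with assms(3) have b: "b > 0" by simp
  from assms(1)[of "1 / b"] b have "s / b \<le> a"
    by (simp add: power2_eq_square field_simps)
  then show ?thesis using b by (simp add: field_simps)
qed

lemma A_inner_simps:
  assumes "positive_op A"
  shows "A_inner A (x + y) z = A_inner A x z + A_inner A y z"
    "A_inner A x (y + z) = A_inner A x y + A_inner A x z"
    "A_inner A (x - y) z = A_inner A x z - A_inner A y z"
    "A_inner A x (y - z) = A_inner A x y - A_inner A x z"
    "A_inner A (c *\<^sub>C x) y = c * A_inner A x y"
    "A_inner A x (c *\<^sub>C y) = cnj c * A_inner A x y"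
  using assms unfolding positive_op_def A_inner_def
  by (auto simp: bounded_clinearD cinner_add_left cinner_add_right cinner_diff_left
      cinner_diff_right cinner_scaleC_left cinner_scaleC_right)

lemma A_inner_commute:
  assumes "positive_op A"
  shows "A_inner A y x = cnj (A_inner A x y)"
  unfolding A_inner_def
  using positive_op_selfadjoint[OF assms, of x y] cinner_commute[of x "A y"] by simp

lemma A_inner_self_nonneg:
  assumes "positive_op A"
  shows "0 \<le> Re (A_inner A x x)"
  using assms unfolding positive_op_def A_inner_def by (auto simp: complex_nonneg_Reals_iff)

lemma A_seminorm_nonneg: "positive_op A \<Longrightarrow> 0 \<le> A_seminorm A x"
  by (simp add: A_seminorm_def A_inner_self_nonneg)

lemma A_seminorm_square: "positive_op A \<Longrightarrow> (A_seminorm A x)\<^sup>2 = Re (A_inner A x x)"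
  by (simp add: A_seminorm_def A_inner_self_nonneg)

lemma A_inner_self:
  assumes "positive_op A"
  shows "A_inner A x x = complex_of_real ((A_seminorm A x)\<^sup>2)"
  using A_inner_commute[OF assms, of x x]
  by (auto simp: complex_eq_iff A_seminorm_square[OF assms])

lemma A_seminorm_scaleC:
  assumes "positive_op A"
  shows "A_seminorm A (c *\<^sub>C x) = cmod c * A_seminorm A x"
proof -
  have "A_inner A (c *\<^sub>C x) (c *\<^sub>C x) = complex_of_real ((cmod c)\<^sup>2) * A_inner A x x"
    by (simp add: A_inner_simps[OF assms] mult.assoc[symmetric] complex_norm_square del: of_real_power)
  then show ?thesis
    unfolding A_seminorm_def by (simp add: real_sqrt_mult)
qed

text \<open>
  The multiple of \<open>y\<close> that is subtracted has the phase of \<open>z\<close>, so that the cross terms become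
  real and add up.
\<close>

lemma A_seminorm_diff_square:
  fixes t :: real
  assumes A: "positive_op A"
    and z: "z = A_inner A x y"
  shows "(A_seminorm A (x - (of_real t * z) *\<^sub>C y))\<^sup>2
    = (A_seminorm A x)\<^sup>2 - 2 * t * (cmod z)\<^sup>2 + t\<^sup>2 * ((cmod z)\<^sup>2 * (A_seminorm A y)\<^sup>2)"
proof -
  let ?c = "of_real t * z"
  have "A_inner A (x - ?c *\<^sub>C y) (x - ?c *\<^sub>C y)
    = A_inner A x x - of_real t * (z * cnj z) - of_real t * (z * cnj z)
      + of_real (t\<^sup>2) * (z * cnj z) * A_inner A y y"
    using A_inner_commute[OF A, of y x]
    by (simp add: A_inner_simps[OF A] z algebra_simps power2_eq_square)
  also have "\<dots> = of_real ((A_seminorm A x)\<^sup>2 - 2 * t * (cmod z)\<^sup>2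
      + t\<^sup>2 * ((cmod z)\<^sup>2 * (A_seminorm A y)\<^sup>2))"
    unfolding A_inner_self[OF A] complex_norm_square[symmetric] by simp
  finally show ?thesis
    using A_seminorm_square[OF A, of "x - ?c *\<^sub>C y"] by simp
qed

lemma A_Cauchy_Schwarz:
  assumes A: "positive_op A"
  shows "cmod (A_inner A x y) \<le> A_seminorm A x * A_seminorm A y"
proof -
  define z where "z = A_inner A x y"
  have "0 \<le> (A_seminorm A x)\<^sup>2 - 2 * t * (cmod z)\<^sup>2 + t\<^sup>2 * ((cmod z)\<^sup>2 * (A_seminorm A y)\<^sup>2)"
    for t :: real
    using A_seminorm_diff_square[OF A z_def, of t] zero_le_power2 by metis
  from nonneg_parabola_imp[OF this] have "(cmod z)\<^sup>2 \<le> (A_seminorm A x * A_seminorm A y)\<^sup>2"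
    by (simp add: power_mult_distrib)
  then show ?thesis
    unfolding z_def using A_seminorm_nonneg[OF A] by (meson mult_nonneg_nonneg power2_le_imp_le)
qed

lemma A_seminorm_id: "A_seminorm id x = norm x"
  by (simp add: A_seminorm_def A_inner_def cinner_self)

lemma Cauchy_Schwarz: "cmod (cinner x y) \<le> norm x * norm y" for x y :: "'a::chilbert_space"
  using A_Cauchy_Schwarz[OF positive_op_id, of x y] by (simp add: A_seminorm_id A_inner_def)

lemma bounded_linear_cinner_left: "bounded_linear (\<lambda>x. cinner x y)" for y :: "'a::chilbert_space"
  by (rule bounded_linear_intro[where K = "norm y"])
    (auto simp: cinner_add_left cinner_scaleC_left scaleR_scaleC Cauchy_Schwarz scaleR_conv_of_real)

lemma bounded_linear_cinner_right: "bounded_linear (\<lambda>y. cinner x y)" for x :: "'a::chilbert_space"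
  by (rule bounded_linear_intro[where K = "norm x"])
    (auto simp: cinner_add_right cinner_scaleC_right scaleR_scaleC scaleR_conv_of_real
      Cauchy_Schwarz mult.commute[of "norm _" "norm x"])

section \<open>Orthogonal projection and Riesz representation\<close>

lemma norm_square_cinner: "(norm x)\<^sup>2 = Re (cinner x x)" for x :: "'a::complex_inner"
  by (simp add: cinner_self)

lemma parallelogram:
  fixes x y :: "'a::complex_inner"
  shows "(norm (x + y))\<^sup>2 + (norm (x - y))\<^sup>2 = 2 * (norm x)\<^sup>2 + 2 * (norm y)\<^sup>2"
  unfolding norm_square_cinner
  by (simp add: cinner_add_left cinner_add_right cinner_diff_left cinner_diff_right)

text \<open>
  Near-minimizers of the distance form nested closed sets. By the parallelogram law and convexity
  (only midpoints enter) their diameters shrink to zero, so completeness yields a common point.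
\<close>

lemma closest_point_exists:
  fixes M :: "'a::chilbert_space set"
  assumes cl: "closed M" and ne: "M \<noteq> {}"
    and mid: "\<And>x y. x \<in> M \<Longrightarrow> y \<in> M \<Longrightarrow> (1/2) *\<^sub>R (x + y) \<in> M"
  shows "\<exists>p\<in>M. \<forall>m\<in>M. norm (w - p) \<le> norm (w - m)"
proof -
  define d where "d = infdist w M"
  have d_le: "d \<le> norm (w - m)" if "m \<in> M" for m
    unfolding d_def dist_norm[symmetric] using infdist_le[OF that] .
  have d0: "0 \<le> d" by (simp add: d_def infdist_nonneg)
  define S where "S n = {m \<in> M. norm (w - m) \<le> d + 1 / real (Suc n)}" for n
  have "S n = M \<inter> cball w (d + 1 / real (Suc n))" for n
    by (auto simp: S_def dist_norm)
  then have closedS: "closed (S n)" for n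
    using cl by auto
  have neS: "S n \<noteq> {}" for n
  proof -
    have "(INF a\<in>M. dist w a) < d + 1 / real (Suc n)"
      using ne by (simp add: d_def infdist_notempty)
    then obtain m where "m \<in> M" "dist w m < d + 1 / real (Suc n)"
      using ne by (subst (asm) cINF_less_iff) auto
    then show ?thesis by (auto simp: S_def dist_norm intro: exI[of _ m])
  qed
  have decS: "S n \<subseteq> S m" if "m \<le> n" for m n
  proof -
    have "1 / real (Suc n) \<le> 1 / real (Suc m)"
      using that by (simp add: frac_le)
    then show ?thesis by (auto simp: S_def)
  qed
  \<comment> \<open>For \<open>x\<close>, \<open>y\<close> within \<open>d + h\<close> of \<open>w\<close>, the midpoint has distance at least \<open>d\<close>, so the parallelogram
    law leaves at most \<open>4 (d + h)\<^sup>2 - 4 d\<^sup>2 = 4 h (2 d + h)\<close> for the square of \<open>dist x y\<close>.\<close>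
  have diam: "\<exists>n. \<forall>x\<in>S n. \<forall>y\<in>S n. dist x y < e" if "e > 0" for e
  proof -
    have "0 < e\<^sup>2 / (4 * (2 * d + 1))"
      using that d0 by simp
    then obtain n where n: "inverse (real (Suc n)) < e\<^sup>2 / (4 * (2 * d + 1))"
      using reals_Archimedean[of "e\<^sup>2 / (4 * (2 * d + 1))"] by blast
    define h where "h = 1 / real (Suc n)"
    have h: "0 < h" "h \<le> 1" "4 * h * (2 * d + 1) < e\<^sup>2"
      using n d0 by (auto simp: h_def field_simps)
    have "dist x y < e" if x: "x \<in> S n" and y: "y \<in> S n" for x y
    proof -
      have "w - (1/2) *\<^sub>R (x + y) = (1/2) *\<^sub>R ((w - x) + (w - y))"
        by (simp add: algebra_simps) (simp add: scaleR_left_distrib[symmetric] scaleR_right_distrib[symmetric])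
      moreover have "d \<le> norm (w - (1/2) *\<^sub>R (x + y))"
        using x y by (auto simp: S_def intro!: d_le mid)
      ultimately have "2 * d \<le> norm ((w - x) + (w - y))"
        by simp
      then have "(2 * d)\<^sup>2 \<le> (norm ((w - x) + (w - y)))\<^sup>2"
        using d0 by (intro power_mono) auto
      moreover have "(norm (w - x))\<^sup>2 \<le> (d + h)\<^sup>2" "(norm (w - y))\<^sup>2 \<le> (d + h)\<^sup>2"
        using x y by (auto simp: S_def h_def intro!: power_mono)
      moreover have "(norm (x - y))\<^sup>2 = (norm ((w - x) - (w - y)))\<^sup>2"
        by (simp add: norm_minus_commute)
      ultimately have "(norm (x - y))\<^sup>2 \<le> 4 * (d + h)\<^sup>2 - (2 * d)\<^sup>2"
        using parallelogram[of "w - x" "w - y"] by linarith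
      also have "\<dots> = 4 * h * (2 * d + h)"
        by (simp add: power2_eq_square algebra_simps)
      also have "\<dots> \<le> 4 * h * (2 * d + 1)"
        using h by (intro mult_left_mono) auto
      also have "\<dots> < e\<^sup>2" by (rule h)
      finally show ?thesis
        using that \<open>e > 0\<close> by (simp add: dist_norm power2_less_imp_less)
    qed
    then show ?thesis by blast
  qed
  obtain p where p: "\<And>n. p \<in> S n"
    using decreasing_closed_nest[of S] closedS neS decS diam by metis
  have "norm (w - p) \<le> d"
  proof (rule field_le_epsilon)
    fix e :: real assume "e > 0"
    then obtain n where "inverse (real (Suc n)) < e"
      using reals_Archimedean by blast
    with p[of n] show "norm (w - p) \<le> d + e" by (auto simp: S_def inverse_eq_divide)
  qed
  then show ?thesis
    using p[of 0] d_le by (force simp: S_def)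
qed

text \<open>
  Moving from the closest point \<open>p\<close> along \<open>m\<close> cannot decrease the distance to \<open>w\<close>. This is the
  hypothesis of \<open>nonneg_parabola_imp\<close> with \<open>a = 0\<close>, which makes the inner product vanish.
\<close>

lemma orthogonal_projection_exists:
  fixes M :: "'a::chilbert_space set"
  assumes cl: "closed M" and zero: "0 \<in> M"
    and add: "\<And>x y. x \<in> M \<Longrightarrow> y \<in> M \<Longrightarrow> x + y \<in> M"
    and scale: "\<And>c x. x \<in> M \<Longrightarrow> c *\<^sub>C x \<in> M"
  shows "\<exists>p\<in>M. \<forall>m\<in>M. cinner (w - p) m = 0"
proof -
  obtain p where p: "p \<in> M" "\<And>m. m \<in> M \<Longrightarrow> norm (w - p) \<le> norm (w - m)"
    using closest_point_exists[OF cl, of w] zero add scale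
    unfolding scaleR_scaleC by blast
  have "cinner (w - p) m = 0" if m: "m \<in> M" for m
  proof -
    define z where "z = cinner (w - p) m"
    have "0 \<le> 0 - 2 * t * (cmod z)\<^sup>2 + t\<^sup>2 * ((cmod z)\<^sup>2 * (norm m)\<^sup>2)" for t :: real
    proof -
      let ?c = "of_real t * z"
      have "(norm (w - p - ?c *\<^sub>C m))\<^sup>2
        = (norm (w - p))\<^sup>2 - 2 * t * (cmod z)\<^sup>2 + t\<^sup>2 * ((cmod z)\<^sup>2 * (norm m)\<^sup>2)"
        using A_seminorm_diff_square[OF positive_op_id, of z "w - p" m t]
        by (simp add: A_seminorm_id A_inner_def z_def)
      moreover have "norm (w - p) \<le> norm (w - (p + ?c *\<^sub>C m))"
        by (intro p add scale m)
      ultimately show ?thesis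
        using power_mono[of "norm (w - p)" "norm (w - p - ?c *\<^sub>C m)" 2] by (simp add: diff_diff_eq)
    qed
    from nonneg_parabola_imp[OF this] show ?thesis
      by (simp add: z_def)
  qed
  with p show ?thesis by blast
qed

text \<open>
  A nonzero vector \<open>v\<close> orthogonal to the kernel of \<open>f\<close> represents \<open>f\<close> up to a scalar, since
  \<open>x - (f x / f v) v\<close> lies in that kernel.
\<close>

lemma Riesz_representation:
  fixes f :: "'a::chilbert_space \<Rightarrow> complex"
  assumes bl: "bounded_linear f" and scale: "\<And>c x. f (c *\<^sub>C x) = c * f x"
  shows "\<exists>z. \<forall>x. f x = cinner x z"
proof (cases "\<forall>x. f x = 0")
  case True
  then show ?thesis by (intro exI[of _ 0]) (simp add: cinner_zero_right)
next
  case False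
  then obtain w where w: "f w \<noteq> 0" by blast
  interpret f: bounded_linear f by fact
  define M where "M = {x. f x = 0}"
  have "M = f -` {0}" by (auto simp: M_def)
  then have "closed M"
    by (simp add: continuous_closed_vimage f.continuous)
  then obtain p where p: "f p = 0" "\<And>m. f m = 0 \<Longrightarrow> cinner (w - p) m = 0"
    using orthogonal_projection_exists[of M w] by (auto simp: M_def f.zero f.add scale)
  define v where "v = w - p"
  have fv: "f v \<noteq> 0" using w p by (simp add: v_def f.diff)
  have vv: "cinner v v \<noteq> 0" using fv f.zero cinner_eq_zero_imp[of v] by auto
  have "f x = cinner x ((cnj (f v) / cinner v v) *\<^sub>C v)" for x
  proof -
    have "cinner v (x - (f x / f v) *\<^sub>C v) = 0"
      unfolding v_def by (rule p) (use fv in \<open>simp add: f.diff scale v_def[symmetric]\<close>)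
    then have "cinner v x = cnj (f x / f v) * cinner v v"
      by (simp add: cinner_diff_right cinner_scaleC_right)
    then have "cinner x v = (f x / f v) * cnj (cinner v v)"
      using cinner_commute[of x v] by simp
    then show ?thesis
      using fv vv by (simp add: cinner_scaleC_right)
  qed
  then show ?thesis by blast
qed

lemma cinner_cadjoint:
  fixes T :: "'a::chilbert_space \<Rightarrow> 'a"
  assumes T: "bounded_clinear T"
  shows "cinner (T x) y = cinner x (cadjoint T y)"
proof -
  note lin = bounded_clinearD[OF T]
  have "\<exists>z. \<forall>x. cinner (T x) y = cinner x z" for y
    by (rule Riesz_representation)
      (auto simp: lin cinner_scaleC_left
        intro!: bounded_linear_compose[OF bounded_linear_cinner_left lin(1)])
  then obtain T' where T': "\<And>x y. cinner (T x) y = cinner x (T' y)" by metis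
  have "\<forall>x y. cinner (T x) y = cinner x (cadjoint T y)"
    unfolding cadjoint_def
  proof (rule theI[of _ T'])
    show "\<forall>x y. cinner (T x) y = cinner x (T' y)" using T' by blast
    show "S = T'" if S: "\<forall>x y. cinner (T x) y = cinner x (S y)" for S
    proof
      show "S y = T' y" for y
        using S T' by (intro cinner_eqI) metis
    qed
  qed
  then show ?thesis by blast
qed

section \<open>Uniform boundedness and existence of the A-adjoint\<close>

text \<open>
  The closed sets on which the whole family is bounded by \<open>n\<close> cover the space, so by Baire's theorem
  one of them contains a ball. Its centre \<open>a\<close> is removed by writing \<open>f y = f (a + y) - f a\<close>.
\<close>

lemma uniform_boundedness:
  fixes F :: "('a::banach \<Rightarrow> 'b::real_normed_vector) set"
  assumes bl: "\<And>f. f \<in> F \<Longrightarrow> bounded_linear f"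
    and pt: "\<And>x. \<exists>c. \<forall>f\<in>F. norm (f x) \<le> c"
  shows "\<exists>C\<ge>0. \<forall>f\<in>F. \<forall>x. norm (f x) \<le> C * norm x"
proof -
  define E where "E n = (\<Inter>f\<in>F. {x. norm (f x) \<le> real n})" for n :: nat
  have closedE: "closed (E n)" for n
    unfolding E_def
    by (intro closed_INT ballI closed_Collect_le continuous_intros
        linear_continuous_on bl)
  have "x \<in> (\<Union>n. E n)" for x
  proof -
    obtain c where c: "\<forall>f\<in>F. norm (f x) \<le> c" using pt by blast
    obtain n where "c \<le> real n" using real_arch_simple by blast
    with c have "x \<in> E n" by (force simp: E_def)
    then show ?thesis by blast
  qed
  then have un: "\<Union>(range E) = UNIV" by auto
  obtain n where n: "interior (E n) \<noteq> {}"
  proof -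
    have "\<exists>n. interior (E n) \<noteq> {}"
    proof (rule ccontr)
      assume "\<not> ?thesis"
      then have "euclidean interior_of \<Union>(range E) = {}"
        using closedE
        by (intro Baire_category_alt) (auto simp: completely_metrizable_space_euclidean)
      with un show False by simp
    qed
    then show ?thesis using that by blast
  qed
  then obtain a r where r: "r > 0" "cball a r \<subseteq> E n"
    by (meson all_not_in_conv interior_subset mem_interior_cball)
  have "norm (f x) \<le> (2 * real n / r) * norm x" if f: "f \<in> F" for f x
  proof (cases "x = 0")
    case True
    then show ?thesis using bl[OF f] by (simp add: linear_simps)
  next
    case False
    interpret bounded_linear f using bl[OF f] .
    define y where "y = (r / norm x) *\<^sub>R x"
    have "a + y \<in> E n" "a \<in> E n"
      using r False by (auto simp: y_def dist_norm subset_iff)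
    then have "norm (f (a + y)) \<le> real n" "norm (f a) \<le> real n"
      using f by (auto simp: E_def)
    then have "norm (f y) \<le> 2 * real n"
      using norm_triangle_ineq4[of "f (a + y)" "f a"] by (simp add: add)
    then show ?thesis
      using r False by (simp add: y_def scaleR field_simps)
  qed
  then show ?thesis using r by (intro exI[of _ "2 * real n / r"]) auto
qed

lemma bounded_linear_scaleC: "bounded_linear (\<lambda>x :: 'a::chilbert_space. c *\<^sub>C x)"
proof (rule bounded_linear_intro[where K = "cmod c"])
  fix x :: 'a
  show "norm (c *\<^sub>C x) \<le> norm x * cmod c"
    using A_seminorm_scaleC[OF positive_op_id, of c x] by (simp add: A_seminorm_id)
qed (auto simp: scaleC_add_right scaleR_scaleC scaleC_scaleC mult.commute)

lemma closure_range_clinear: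
  fixes A :: "'a::chilbert_space \<Rightarrow> 'a"
  assumes A: "bounded_clinear A"
  shows "0 \<in> closure (range A)"
    and "x \<in> closure (range A) \<Longrightarrow> y \<in> closure (range A) \<Longrightarrow> x + y \<in> closure (range A)"
    and "x \<in> closure (range A) \<Longrightarrow> c *\<^sub>C x \<in> closure (range A)"
proof -
  note lin = bounded_clinearD[OF A]
  have in_M: "A z \<in> closure (range A)" for z
    by (rule subsetD[OF closure_subset rangeI])
  from in_M[of 0]
  show "0 \<in> closure (range A)" by (simp only: lin(5))
  have add: "u + v \<in> range A" if uv: "u \<in> range A" "v \<in> range A" for u v
  proof -
    obtain a b where "u = A a" "v = A b" using uv by blast
    then have "u + v = A (a + b)" by (simp only: lin(2))
    then show ?thesis by blast
  qed
  show "x + y \<in> closure (range A)" if "x \<in> closure (range A)" "y \<in> closure (range A)"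
  proof -
    obtain u where u: "\<forall>n. u n \<in> range A" "u \<longlonglongrightarrow> x"
      using \<open>x \<in> closure (range A)\<close> unfolding closure_sequential by blast
    obtain v where v: "\<forall>n. v n \<in> range A" "v \<longlonglongrightarrow> y"
      using \<open>y \<in> closure (range A)\<close> unfolding closure_sequential by blast
    have "\<forall>n. u n + v n \<in> range A" using u(1) v(1) add by blast
    moreover have "(\<lambda>n. u n + v n) \<longlonglongrightarrow> x + y" using u(2) v(2) by (rule tendsto_add)
    ultimately show ?thesis
      unfolding closure_sequential by (intro exI[of _ "\<lambda>n. u n + v n"] conjI)
  qed
  show "c *\<^sub>C x \<in> closure (range A)" if "x \<in> closure (range A)"
  proof -
    have "(\<lambda>x. c *\<^sub>C x) ` closure (range A) \<subseteq> closure (range A)"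
    proof (rule image_closure_subset)
      show "continuous_on (closure (range A)) ((*\<^sub>C) c)"
        using bounded_linear_scaleC by (rule linear_continuous_on)
      show "(*\<^sub>C) c ` range A \<subseteq> closure (range A)"
      proof (rule image_subsetI)
        fix u assume "u \<in> range A"
        then obtain a where "u = A a" by blast
        then have "c *\<^sub>C u = A (c *\<^sub>C a)" by (simp only: lin(4))
        with in_M show "c *\<^sub>C u \<in> closure (range A)" by simp
      qed
    qed simp
    with that show ?thesis by blast
  qed
qed

text \<open>
  The closure of the range is the orthogonal complement of the kernel: a vector that \<open>A\<close> kills is
  orthogonal to the range, hence to its closure. This gives the uniqueness of the A-adjoint,
  and uniqueness in turn makes the pointwise solution linear.
\<close>

lemma positive_op_inj_on_closure_range:
  assumes A: "positive_op A" and u: "u \<in> closure (range A)" and v: "v \<in> closure (range A)"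
    and eq: "A u = A v"
  shows "u = v"
proof -
  have cl: "bounded_clinear A" using A by (simp add: positive_op_def)
  note lin = bounded_clinearD[OF cl]
  define d where "d = u - v"
  have "d = u + (- 1) *\<^sub>C v" by (simp add: d_def minus_eq_scaleC[symmetric])
  then have d: "d \<in> closure (range A)"
    using closure_range_clinear[OF cl] u v by simp
  have "closure (range A) \<subseteq> {m. cinner d m = 0}"
  proof (rule closure_minimal)
    show "range A \<subseteq> {m. cinner d m = 0}"
      using positive_op_selfadjoint[OF A, of d] eq by (auto simp: d_def lin cinner_zero_left)
    show "closed {m. cinner d m = 0}"
      by (intro closed_Collect_eq linear_continuous_on bounded_linear_cinner_right continuous_intros)
  qed
  with d have "d = 0" using cinner_eq_zero_imp by auto
  then show ?thesis by (simp add: d_def)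
qed

text \<open>
  Projecting a solution \<open>w\<close> of \<open>A w = T\<^sup>* A x\<close> onto the closure of the range does not change \<open>A w\<close>.
  This gives \<open>X\<close> pointwise. For its continuity, test against the range: \<open>\<langle>X x, A z\<rangle> = \<langle>x, A T z\<rangle>\<close>
  is continuous in \<open>x\<close>, and bounded by \<open>\<parallel>X x\<parallel> \<parallel>A z\<parallel>\<close>. Uniform
  boundedness replaces \<open>\<parallel>X x\<parallel>\<close> by a multiple of \<open>\<parallel>x\<parallel>\<close>, and since \<open>X x\<close> lies in the closure of the
  range, these test vectors determine its norm.
\<close>

lemma A_adjoint_exists:
  assumes A: "positive_op A" and T: "T \<in> B_A A"
  shows "\<exists>X. bounded_clinear X \<and> A \<circ> X = cadjoint T \<circ> A \<and> range X \<subseteq> closure (range A)"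
proof -
  let ?M = "closure (range A)"
  have cl: "bounded_clinear A" using A by (simp add: positive_op_def)
  note lin = bounded_clinearD[OF cl]
  note M = closure_range_clinear[OF cl]
  have clT: "bounded_clinear T" using T by (simp add: B_A_def)
  note sa = positive_op_selfadjoint[OF A]
  have "\<exists>u\<in>?M. A u = cadjoint T (A x)" for x
  proof -
    have "cadjoint T (A x) \<in> range A" using T by (auto simp: B_A_def)
    then obtain w where w: "cadjoint T (A x) = A w" by blast
    obtain p where p: "p \<in> ?M" "\<And>m. m \<in> ?M \<Longrightarrow> cinner (w - p) m = 0"
      using orthogonal_projection_exists[of ?M w] M by auto
    have "A w = A p"
    proof (rule cinner_eqI_left)
      fix z
      have "A z \<in> ?M" by (rule subsetD[OF closure_subset rangeI])
      from p(2)[OF this] show "cinner (A w) z = cinner (A p) z"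
        by (simp add: sa cinner_diff_left)
    qed
    with p w show ?thesis by auto
  qed
  then obtain X where X: "\<And>x. X x \<in> ?M" "\<And>x. A (X x) = cadjoint T (A x)" by metis
  have adj: "cinner z (A (X x)) = cinner (T z) (A x)" for x z
    unfolding X cinner_cadjoint[OF clT] ..
  have Xadd: "X (x + y) = X x + X y" for x y
  proof (rule positive_op_inj_on_closure_range[OF A])
    show "A (X (x + y)) = A (X x + X y)"
      by (rule cinner_eqI) (simp add: lin(2) adj cinner_add_right)
  qed (use X M in auto)
  have Xscale: "X (c *\<^sub>C x) = c *\<^sub>C X x" for c x
  proof (rule positive_op_inj_on_closure_range[OF A])
    show "A (X (c *\<^sub>C x)) = A (c *\<^sub>C X x)"
      by (rule cinner_eqI) (simp add: lin(4) adj cinner_scaleC_right)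
  qed (use X M in auto)
  have test: "cinner (X x) (A z) = cinner x (A (T z))" for x z
    by (metis adj sa cinner_commute)
  \<comment> \<open>Division by zero yields zero, so vectors \<open>z\<close> in the kernel of \<open>A\<close> only add the zero functional.\<close>
  define F where "F = range (\<lambda>z x. cinner (X x) (A z) / of_real (norm (A z)))"
  have blF: "bounded_linear f" if "f \<in> F" for f
    using that unfolding F_def
    by (auto simp: test intro!: bounded_linear_compose[OF bounded_linear_divide bounded_linear_cinner_left])
  have ptF: "\<exists>c. \<forall>f\<in>F. norm (f x) \<le> c" for x
  proof -
    have "norm (cinner (X x) (A z) / of_real (norm (A z))) \<le> norm (X x)" for z
      using Cauchy_Schwarz[of "X x" "A z"]
      by (cases "A z = 0") (auto simp: norm_divide field_simps)
    then show ?thesis by (auto simp: F_def)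
  qed
  obtain C where C: "C \<ge> 0" "\<And>f x. f \<in> F \<Longrightarrow> norm (f x) \<le> C * norm x"
    using uniform_boundedness[of F, OF blF ptF] by blast
  have bound: "norm (X x) \<le> C * norm x" for x
  proof -
    have "?M \<subseteq> {u. cmod (cinner (X x) u) \<le> C * norm x * norm u}"
    proof (rule closure_minimal)
      show "closed {u. cmod (cinner (X x) u) \<le> C * norm x * norm u}"
        by (intro closed_Collect_le continuous_intros linear_continuous_on bounded_linear_cinner_right)
      have "cmod (cinner (X x) (A z)) \<le> C * norm x * norm (A z)" for z
      proof (cases "A z = 0")
        case False
        have "norm (cinner (X x) (A z) / of_real (norm (A z))) \<le> C * norm x"
          by (rule C(2)[of "\<lambda>x. cinner (X x) (A z) / of_real (norm (A z))"]) (auto simp: F_def)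
        with False show ?thesis by (simp add: norm_divide field_simps)
      qed (simp add: cinner_zero_right)
      then show "range A \<subseteq> {u. cmod (cinner (X x) u) \<le> C * norm x * norm u}" by auto
    qed
    with X(1) have "cmod (cinner (X x) (X x)) \<le> C * norm x * norm (X x)" by blast
    then have "norm (X x) * norm (X x) \<le> C * norm x * norm (X x)"
      by (simp add: cinner_self norm_mult power2_eq_square)
    then show ?thesis
      using C(1) by (cases "X x = 0") auto
  qed
  have "bounded_clinear X"
    unfolding bounded_clinear_def
    using Xadd Xscale bound
    by (auto intro!: bounded_linear_intro[where K = C] simp: scaleR_scaleC mult.commute)
  with X show ?thesis
    by (intro exI[of _ X]) (auto simp: fun_eq_iff)
qed

lemma A_adjoint_spec:
  assumes A: "positive_op A" and T: "T \<in> B_A A"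
  shows "bounded_clinear (A_adjoint A T)" "A (A_adjoint A T x) = cadjoint T (A x)"
proof -
  let ?P = "\<lambda>X. bounded_clinear X \<and> A \<circ> X = cadjoint T \<circ> A \<and> range X \<subseteq> closure (range A)"
  obtain X where X: "?P X" using A_adjoint_exists[OF A T] by blast
  have "Y = X" if "?P Y" for Y
  proof
    fix x
    have "A (Y x) = A (X x)" using X that by (metis comp_apply)
    moreover have "Y x \<in> closure (range A)" "X x \<in> closure (range A)"
      using X that by blast+
    ultimately show "Y x = X x"
      using positive_op_inj_on_closure_range[OF A] by metis
  qed
  with X have P: "?P (A_adjoint A T)"
    unfolding A_adjoint_def by (rule theI)
  then show "bounded_clinear (A_adjoint A T)" by blast
  from P have "A \<circ> A_adjoint A T = cadjoint T \<circ> A" by blast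
  then show "A (A_adjoint A T x) = cadjoint T (A x)"
    by (rule comp_eq_dest)
qed

text \<open>
  With respect to the A-form, \<open>A_adjoint A T\<close> behaves like an adjoint of \<open>T\<close>. All later arguments
  use it only through these two identities and its bounded linearity.
\<close>

lemma A_inner_A_adjoint:
  assumes A: "positive_op A" and T: "T \<in> B_A A"
  shows "A_inner A x (A_adjoint A T y) = A_inner A (T x) y"
    and "A_inner A (A_adjoint A T y) x = A_inner A y (T x)"
proof -
  have clT: "bounded_clinear T" using T by (simp add: B_A_def)
  show eq: "A_inner A x (A_adjoint A T y) = A_inner A (T x) y"
    unfolding A_inner_def positive_op_selfadjoint[OF A] A_adjoint_spec[OF A T]
    by (simp add: cinner_cadjoint[OF clT])
  show "A_inner A (A_adjoint A T y) x = A_inner A y (T x)"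
    using eq A_inner_commute[OF A] by metis
qed

section \<open>A-boundedness\<close>

definition A_bounded :: "('a::chilbert_space \<Rightarrow> 'a) \<Rightarrow> ('a \<Rightarrow> 'a) \<Rightarrow> bool" where
  "A_bounded A T \<longleftrightarrow> (\<exists>c\<ge>0. \<forall>x. A_seminorm A (T x) \<le> c * A_seminorm A x)"

lemma A_bounded_compose:
  assumes "A_bounded A S" "A_bounded A T"
  shows "A_bounded A (S \<circ> T)"
proof -
  obtain c d where c: "c \<ge> 0" "\<And>x. A_seminorm A (S x) \<le> c * A_seminorm A x"
    and d: "d \<ge> 0" "\<And>x. A_seminorm A (T x) \<le> d * A_seminorm A x"
    using assms unfolding A_bounded_def by blast
  have "A_seminorm A (S (T x)) \<le> c * d * A_seminorm A x" for x
    using c(2)[of "T x"] mult_left_mono[OF d(2)[of x] c(1)] by simp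
  with c d show ?thesis unfolding A_bounded_def by (intro exI[of _ "c * d"]) auto
qed

lemma A_seminorm_le_norm:
  assumes A: "positive_op A"
  shows "\<exists>k\<ge>0. \<forall>x. A_seminorm A x \<le> k * norm x"
proof -
  have "bounded_linear A" using A by (simp add: positive_op_def bounded_clinear_def)
  then obtain k where k: "k > 0" "\<And>x. norm (A x) \<le> norm x * k"
    using bounded_linear.pos_bounded by blast
  have "A_seminorm A x \<le> sqrt k * norm x" for x
  proof -
    have "Re (A_inner A x x) \<le> norm (A x) * norm x"
      unfolding A_inner_def using complex_Re_le_cmod Cauchy_Schwarz order_trans by blast
    also have "\<dots> \<le> norm x * k * norm x"
      using k by (intro mult_right_mono) auto
    also have "\<dots> = k * (norm x)\<^sup>2"
      by (simp add: power2_eq_square)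
    finally show ?thesis
      unfolding A_seminorm_def using real_sqrt_le_mono by (fastforce simp: real_sqrt_mult)
  qed
  with k show ?thesis by (intro exI[of _ "sqrt k"]) auto
qed

text \<open>
  The quotients of successive terms of a log-convex sequence increase, so the first quotient cannot
  exceed the exponential growth rate of the sequence.
\<close>

lemma log_convex_growth:
  fixes a :: "nat \<Rightarrow> real"
  assumes nonneg: "\<And>n. 0 \<le> a n" and lc: "\<And>n. (a (Suc n))\<^sup>2 \<le> a n * a (Suc (Suc n))"
    and c: "c > 0" and bd: "\<And>n. a n \<le> C * c ^ n"
  shows "a 1 \<le> c * a 0"
proof (rule ccontr)
  assume "\<not> a 1 \<le> c * a 0"
  then have gt: "c * a 0 < a 1" by simp
  have a0: "a 0 > 0"
  proof (rule ccontr)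
    assume "\<not> a 0 > 0"
    with nonneg[of 0] have "a 0 = 0" by simp
    with lc[of 0] gt show False by simp
  qed
  define r where "r = a 1 / a 0"
  have r: "r > c" using gt a0 by (simp add: r_def field_simps)
  have step: "0 < a n \<and> r * a n \<le> a (Suc n)" for n
  proof (induction n)
    case 0
    then show ?case using a0 by (simp add: r_def)
  next
    case (Suc n)
    have "0 < r * a n" using Suc r c by simp
    then have pos: "0 < a (Suc n)" using Suc by linarith
    have "r * a (Suc n) * a n \<le> (a (Suc n))\<^sup>2"
      using Suc pos by (simp add: power2_eq_square mult_ac mult_left_mono)
    also have "\<dots> \<le> a (Suc (Suc n)) * a n" using lc[of n] by (simp add: mult.commute)
    finally show ?case using Suc pos by simp
  qed
  have growth: "r ^ n * a 0 \<le> a n" for n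
  proof (induction n)
    case (Suc n)
    have "r ^ Suc n * a 0 \<le> r * a n"
      using Suc r c by (simp add: mult.assoc)
    then show ?case using step[of n] by linarith
  qed simp
  obtain n where n: "C / a 0 < (r / c) ^ n"
    using real_arch_pow[of "r / c" "C / a 0"] r c by auto
  have "r ^ n * a 0 \<le> C * c ^ n" using growth bd order_trans by blast
  with n a0 c show False by (simp add: power_divide field_simps)
qed

text \<open>
  Krein's argument: by symmetry and the Cauchy-Schwarz inequality the sequence \<open>\<parallel>B\<^sup>n x\<parallel>\<^sub>A\<close> is
  log-convex, and it grows at most like \<open>c\<^sup>n\<close>, where \<open>c\<close> bounds \<open>B\<close> in the ordinary norm. Hence the same
  constant \<open>c\<close> bounds \<open>B\<close> in the seminorm.
\<close>

lemma A_symmetric_A_bounded: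
  assumes A: "positive_op A" and B: "bounded_clinear B"
    and sym: "\<And>x y. A_inner A (B x) y = A_inner A x (B y)"
  shows "A_bounded A B"
proof -
  obtain k where k: "k \<ge> 0" "\<And>x. A_seminorm A x \<le> k * norm x"
    using A_seminorm_le_norm[OF A] by blast
  obtain c where c: "c > 0" "\<And>x. norm (B x) \<le> norm x * c"
    using bounded_linear.pos_bounded[OF bounded_clinearD(1)[OF B]] by blast
  have "A_seminorm A (B x) \<le> c * A_seminorm A x" for x
  proof -
    define a where "a n = A_seminorm A ((B ^^ n) x)" for n
    have it: "norm ((B ^^ n) x) \<le> norm x * c ^ n" for n
    proof (induction n)
      case (Suc n)
      have "norm (B ((B ^^ n) x)) \<le> norm ((B ^^ n) x) * c" by (rule c)
      also have "\<dots> \<le> norm x * c ^ n * c" using Suc c by (intro mult_right_mono) auto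
      finally show ?case by (simp add: mult_ac)
    qed simp
    have "a 1 \<le> c * a 0"
    proof (rule log_convex_growth)
      show "0 \<le> a n" for n by (simp add: a_def A_seminorm_nonneg[OF A])
      show "(a (Suc n))\<^sup>2 \<le> a n * a (Suc (Suc n))" for n
      proof -
        let ?u = "(B ^^ n) x"
        have "(A_seminorm A (B ?u))\<^sup>2 = Re (A_inner A ?u (B (B ?u)))"
          by (simp add: A_seminorm_square[OF A] sym)
        also have "\<dots> \<le> A_seminorm A ?u * A_seminorm A (B (B ?u))"
          using complex_Re_le_cmod A_Cauchy_Schwarz[OF A] order_trans by blast
        finally show ?thesis by (simp add: a_def)
      qed
      show "a n \<le> k * norm x * c ^ n" for n
        using k(2)[of "(B ^^ n) x"] mult_left_mono[OF it[of n] k(1)] by (simp add: a_def mult.assoc)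
    qed (rule c)
    then show ?thesis by (simp add: a_def)
  qed
  with c show ?thesis unfolding A_bounded_def by (intro exI[of _ c]) auto
qed

text \<open>
  The square of \<open>\<parallel>T x\<parallel>\<^sub>A\<close> is \<open>\<langle>T\<^sup>\<sharp> T x, x\<rangle>\<^sub>A\<close>, and the operator \<open>T\<^sup>\<sharp> T\<close> is
  symmetric for the A-form.
\<close>

lemma B_A_A_bounded:
  assumes A: "positive_op A" and T: "T \<in> B_A A"
  shows "A_bounded A T"
proof -
  let ?B = "A_adjoint A T \<circ> T"
  note adj = A_inner_A_adjoint[OF A T]
  have clT: "bounded_clinear T" using T by (simp add: B_A_def)
  have "A_bounded A ?B"
    using A bounded_clinear_compose[OF A_adjoint_spec(1)[OF A T] clT]
    by (rule A_symmetric_A_bounded) (simp add: adj)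
  then obtain c where c: "c \<ge> 0" "\<And>x. A_seminorm A (?B x) \<le> c * A_seminorm A x"
    unfolding A_bounded_def by blast
  have "A_seminorm A (T x) \<le> sqrt c * A_seminorm A x" for x
  proof -
    have "(A_seminorm A (T x))\<^sup>2 = Re (A_inner A (?B x) x)"
      by (simp add: A_seminorm_square[OF A] adj)
    also have "\<dots> \<le> A_seminorm A (?B x) * A_seminorm A x"
      using complex_Re_le_cmod A_Cauchy_Schwarz[OF A] order_trans by blast
    also have "\<dots> \<le> c * A_seminorm A x * A_seminorm A x"
      using c A_seminorm_nonneg[OF A] by (intro mult_right_mono) auto
    also have "\<dots> = (sqrt c * A_seminorm A x)\<^sup>2"
      using c by (simp add: power_mult_distrib) (simp add: power2_eq_square)
    finally show ?thesis
      using c A_seminorm_nonneg[OF A] by (meson mult_nonneg_nonneg power2_le_imp_le real_sqrt_ge_zero)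
  qed
  with c show ?thesis unfolding A_bounded_def by (intro exI[of _ "sqrt c"]) auto
qed

text \<open>
  By duality: \<open>\<parallel>T\<^sup>\<sharp> x\<parallel>\<^sub>A\<^sup>2 = \<langle>x, T T\<^sup>\<sharp> x\<rangle>\<^sub>A \<le> c \<parallel>x\<parallel>\<^sub>A \<parallel>T\<^sup>\<sharp> x\<parallel>\<^sub>A\<close>.
\<close>

lemma A_adjoint_A_bounded:
  assumes A: "positive_op A" and T: "T \<in> B_A A"
  shows "A_bounded A (A_adjoint A T)"
proof -
  let ?X = "A_adjoint A T"
  obtain c where c: "c \<ge> 0" "\<And>x. A_seminorm A (T x) \<le> c * A_seminorm A x"
    using B_A_A_bounded[OF A T] unfolding A_bounded_def by blast
  have "A_seminorm A (?X x) \<le> c * A_seminorm A x" for x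
  proof -
    let ?s = "A_seminorm A (?X x)"
    note nn = A_seminorm_nonneg[OF A]
    have "?s\<^sup>2 = Re (A_inner A x (T (?X x)))"
      by (subst A_seminorm_square[OF A], subst A_inner_A_adjoint(2)[OF A T]) (rule refl)
    also have "\<dots> \<le> A_seminorm A x * A_seminorm A (T (?X x))"
      using complex_Re_le_cmod A_Cauchy_Schwarz[OF A] order_trans by blast
    also have "\<dots> \<le> A_seminorm A x * (c * ?s)"
      using c nn by (intro mult_left_mono) auto
    finally have "?s * ?s \<le> (c * A_seminorm A x) * ?s"
      by (simp add: power2_eq_square mult_ac)
    then show ?thesis
      using nn[of "?X x"] nn[of x] c by (cases "?s = 0") auto
  qed
  with c show ?thesis unfolding A_bounded_def by (intro exI[of _ c]) auto
qed

section \<open>Operator seminorm and numerical radius\<close>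

text \<open>
  A-boundedness enters twice: it makes the supremum meaningful, and it settles vectors of seminorm
  zero, which cannot be normalized. All other vectors are rescaled to seminorm one. The same holds
  for the numerical radius below.
\<close>

lemma A_norm_bound:
  assumes A: "positive_op A" and T: "A_bounded A T"
  shows A_norm_nonneg: "0 \<le> A_norm A T"
    and A_seminorm_le_A_norm:
      "bounded_clinear T \<Longrightarrow> A_seminorm A (T x) \<le> A_norm A T * A_seminorm A x"
proof -
  obtain c where c: "c \<ge> 0" "\<And>x. A_seminorm A (T x) \<le> c * A_seminorm A x"
    using T unfolding A_bounded_def by blast
  let ?E = "insert 0 {A_seminorm A (T x) | x. A_seminorm A x = 1}"
  have bdd: "bdd_above ?E"
  proof (rule bdd_aboveI[of _ c])
    fix e assume "e \<in> ?E"
    then show "e \<le> c"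
    proof
      assume "e \<in> {A_seminorm A (T x) | x. A_seminorm A x = 1}"
      then obtain u where "e = A_seminorm A (T u)" "A_seminorm A u = 1" by blast
      with c(2)[of u] show ?thesis by simp
    qed (use c in simp)
  qed
  show "0 \<le> A_norm A T" unfolding A_norm_def by (intro cSup_upper bdd) auto
  show "A_seminorm A (T x) \<le> A_norm A T * A_seminorm A x" if cl: "bounded_clinear T"
  proof (cases "A_seminorm A x = 0")
    case True
    with c(2)[of x] show ?thesis by simp
  next
    case False
    then have pos: "A_seminorm A x > 0" using A_seminorm_nonneg[OF A, of x] by simp
    define u where "u = of_real (1 / A_seminorm A x) *\<^sub>C x"
    have "A_seminorm A u = 1"
      using pos by (simp add: u_def A_seminorm_scaleC[OF A] norm_divide)
    then have "A_seminorm A (T u) \<le> A_norm A T"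
      unfolding A_norm_def by (intro cSup_upper bdd) auto
    then show ?thesis
      using pos by (simp add: u_def bounded_clinearD[OF cl] A_seminorm_scaleC[OF A] norm_divide field_simps)
  qed
qed

lemma A_inner_le_A_numerical_radius:
  assumes A: "positive_op A" and T: "A_bounded A T" and cl: "bounded_clinear T"
  shows "cmod (A_inner A (T x) x) \<le> A_numerical_radius A T * (A_seminorm A x)\<^sup>2"
proof -
  obtain c where c: "c \<ge> 0" "\<And>x. A_seminorm A (T x) \<le> c * A_seminorm A x"
    using T unfolding A_bounded_def by blast
  have cs: "cmod (A_inner A (T x) x) \<le> c * (A_seminorm A x)\<^sup>2" for x
  proof -
    have "cmod (A_inner A (T x) x) \<le> A_seminorm A (T x) * A_seminorm A x"
      by (rule A_Cauchy_Schwarz[OF A])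
    also have "\<dots> \<le> c * A_seminorm A x * A_seminorm A x"
      using c A_seminorm_nonneg[OF A] by (intro mult_right_mono) auto
    finally show ?thesis by (simp add: power2_eq_square mult.assoc)
  qed
  let ?E = "insert 0 {cmod (A_inner A (T x) x) | x. A_seminorm A x = 1}"
  have bdd: "bdd_above ?E"
  proof (rule bdd_aboveI[of _ c])
    fix e assume "e \<in> ?E"
    then show "e \<le> c"
    proof
      assume "e \<in> {cmod (A_inner A (T x) x) | x. A_seminorm A x = 1}"
      then obtain u where "e = cmod (A_inner A (T u) u)" "A_seminorm A u = 1" by blast
      with cs[of u] show ?thesis by simp
    qed (use c in simp)
  qed
  show ?thesis
  proof (cases "A_seminorm A x = 0")
    case True
    with cs[of x] show ?thesis by simp
  next
    case False
    then have pos: "A_seminorm A x > 0" using A_seminorm_nonneg[OF A, of x] by simp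
    define r where "r = 1 / A_seminorm A x"
    define u where "u = of_real r *\<^sub>C x"
    have "A_seminorm A u = 1"
      using pos by (simp add: u_def r_def A_seminorm_scaleC[OF A] norm_divide)
    then have "cmod (A_inner A (T u) u) \<le> A_numerical_radius A T"
      unfolding A_numerical_radius_def by (intro cSup_upper bdd) auto
    then have "r\<^sup>2 * cmod (A_inner A (T x) x) \<le> A_numerical_radius A T"
      by (simp add: u_def bounded_clinearD[OF cl] A_inner_simps[OF A] norm_mult power2_eq_square mult.assoc)
    then show ?thesis
      using pos by (simp add: r_def power_divide field_simps)
  qed
qed

text \<open>
  The constants come from \<open>s\<^sup>2 + t\<^sup>2 = 1\<close> for \<open>s = \<parallel>x\<parallel>\<^sub>A\<close>, \<open>t = \<parallel>y\<parallel>\<^sub>A\<close>, which forces \<open>s\<^sup>4 \<le> 1\<close> and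
  \<open>s\<^sup>2 t\<^sup>2 \<le> 1/4\<close>.
\<close>

lemma matrix_row_bound:
  assumes A: "positive_op A" and P: "P \<in> B_A A" and Q: "Q \<in> B_A A"
    and unit: "(A_seminorm A x)\<^sup>2 + (A_seminorm A y)\<^sup>2 = 1"
  shows "cmod (A_inner A (P x + Q y) x)
    \<le> sqrt (2 * (A_numerical_radius A P)\<^sup>2 + 1 / 2 * (A_norm A Q)\<^sup>2)"
proof -
  let ?s = "A_seminorm A x" and ?t = "A_seminorm A y"
  let ?w = "A_numerical_radius A P" and ?q = "A_norm A Q"
  note nn = A_seminorm_nonneg[OF A]
  have cl: "bounded_clinear P" "bounded_clinear Q" using P Q by (auto simp: B_A_def)
  have p: "cmod (A_inner A (P x) x) \<le> ?w * ?s\<^sup>2"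
    using A B_A_A_bounded[OF A P] cl(1) by (rule A_inner_le_A_numerical_radius)
  have "cmod (A_inner A (Q y) x) \<le> A_seminorm A (Q y) * ?s"
    by (rule A_Cauchy_Schwarz[OF A])
  also have "\<dots> \<le> ?q * ?t * ?s"
    using A_seminorm_le_A_norm[OF A B_A_A_bounded[OF A Q] cl(2)] nn by (intro mult_right_mono)
  finally have q: "cmod (A_inner A (Q y) x) \<le> ?q * (?s * ?t)" by (simp add: mult_ac)
  define a b where "a = cmod (A_inner A (P x) x)" and "b = cmod (A_inner A (Q y) x)"
  have "?s\<^sup>2 \<le> 1" using unit zero_le_power2[of ?t] by linarith
  then have "(?s\<^sup>2)\<^sup>2 \<le> 1" using power_le_one[of "?s\<^sup>2" 2] by simp
  then have a: "a\<^sup>2 \<le> ?w\<^sup>2"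
    using power_mono[OF p, of 2] mult_left_mono[of "(?s\<^sup>2)\<^sup>2" 1 "?w\<^sup>2"]
    by (simp add: a_def power_mult_distrib)
  have "2 * (?s * ?t) \<le> 1"
    using unit zero_le_power2[of "?s - ?t"] by (simp add: power2_diff)
  then have "(?s * ?t)\<^sup>2 \<le> (1 / 2)\<^sup>2"
    using nn by (intro power_mono) auto
  then have b: "b\<^sup>2 \<le> ?q\<^sup>2 * (1 / 4)"
    using power_mono[OF q, of 2] mult_left_mono[of "(?s * ?t)\<^sup>2" "(1 / 2)\<^sup>2" "?q\<^sup>2"]
    by (simp add: b_def power_mult_distrib power_divide)
  have "(cmod (A_inner A (P x + Q y) x))\<^sup>2 \<le> (a + b)\<^sup>2"
    unfolding a_def b_def A_inner_simps[OF A] by (intro power_mono norm_triangle_ineq) auto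
  also have "\<dots> \<le> 2 * a\<^sup>2 + 2 * b\<^sup>2"
    using zero_le_power2[of "a - b"] by (simp add: power2_sum power2_diff)
  also have "\<dots> \<le> 2 * ?w\<^sup>2 + 1 / 2 * ?q\<^sup>2" using a b by linarith
  finally show ?thesis by (rule real_le_rsqrt)
qed

theorem theorem2p5:
  fixes A P Q R S :: "'h::chilbert_space \<Rightarrow> 'h"
  assumes "positive_op A"
    and "P \<in> B_A A" and "Q \<in> B_A A" and "R \<in> B_A A" and "S \<in> B_A A"
  shows "A_numerical_radius (op_matrix A (\<lambda>_. 0) (\<lambda>_. 0) A) (op_matrix P Q R S)
    \<le> sqrt (2 * (A_numerical_radius A P)\<^sup>2
              + 1 / 2 * (A_norm A (A_adjoint A P \<circ> Q) + (A_norm A Q)\<^sup>2))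
      + sqrt (2 * (A_numerical_radius A S)\<^sup>2
              + 1 / 2 * (A_norm A (A_adjoint A S \<circ> R) + (A_norm A R)\<^sup>2))"
    (is "A_numerical_radius ?AA ?T \<le> ?rhs1 + ?rhs2")
proof -
  note A = \<open>positive_op A\<close>
  have nn: "0 \<le> A_norm A (A_adjoint A U \<circ> V)" if "U \<in> B_A A" "V \<in> B_A A" for U V
    using that by (intro A_norm_nonneg A A_bounded_compose A_adjoint_A_bounded B_A_A_bounded)
  have row: "cmod (A_inner A (U x + V y) x) \<le> sqrt (2 * (A_numerical_radius A U)\<^sup>2
      + 1 / 2 * (A_norm A (A_adjoint A U \<circ> V) + (A_norm A V)\<^sup>2))"
    if "U \<in> B_A A" "V \<in> B_A A" "(A_seminorm A x)\<^sup>2 + (A_seminorm A y)\<^sup>2 = 1" for U V x y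
    using matrix_row_bound[OF A that] nn[OF that(1,2)]
    by (elim order_trans) simp
  have inner: "A_inner ?AA (x, y) (u, v) = A_inner A x u + A_inner A y v" for x y u v
    by (simp add: A_inner_def op_matrix_def cinner_prod_def)
  have el: "cmod (A_inner ?AA (?T z) z) \<le> ?rhs1 + ?rhs2" if z: "A_seminorm ?AA z = 1" for z
  proof (cases z)
    case (Pair x y)
    have "Re (A_inner A x x + A_inner A y y) = 1"
      using z by (simp add: A_seminorm_def Pair inner)
    then have unit: "(A_seminorm A x)\<^sup>2 + (A_seminorm A y)\<^sup>2 = 1"
      by (simp add: A_seminorm_square[OF A])
    \<comment> \<open>In the second row the diagonal entry is \<open>S\<close>; interchanging the summands brings it to the form
      of the first row, with \<open>x\<close> and \<open>y\<close> interchanged.\<close>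
    have "A_inner ?AA (?T z) z = A_inner A (P x + Q y) x + A_inner A (S y + R x) y"
      using inner by (simp add: Pair op_matrix_def add.commute)
    also have "cmod \<dots> \<le> cmod (A_inner A (P x + Q y) x) + cmod (A_inner A (S y + R x) y)"
      by (rule norm_triangle_ineq)
    also have "\<dots> \<le> ?rhs1 + ?rhs2"
      using unit assms by (intro add_mono row) (auto simp: add.commute)
    finally show ?thesis .
  qed
  have "0 \<le> ?rhs1 + ?rhs2"
    using nn assms by simp
  with el show ?thesis
    unfolding A_numerical_radius_def[of ?AA] by (intro cSup_least) auto
qed

end
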